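(* There are infinitely many pairwise d.p.-inequivalent graph polynomials of the form $\mathbf{P}^{span}_{\mathcal{D}}(G;X)$, where $\mathcal{D}$ ranges over graph properties closed under adding isolated vertices.
   Context: All graphs are finite without multiple edges. A graph property is an isomorphism-closed class of graphs. For a graph property $\mathcal{D}$ closed under adding isolated vertices, $\mathbf{P}^{span}_{\mathcal{D}}(G;X)=\sum_{B\subseteq E(G):(V(G),B)\in\mathcal{D}}X^{|B|}$. Two graph polynomials $\mathbf{P},\mathbf{Q}$ are d.p.-equivalent if for all graphs $G,H$: $\mathbf{P}(G)=\mathbf{P}(H)$ iff $\mathbf{Q}(G)=\mathbf{Q}(H)$. *)

theory Defs
  imports "HOL-Computational_Algebra.Polynomial"
begin

text \<open>
  A graph is a pair of a vertex set and a set of undirected edges; an edge is the set of its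
  endpoints, so there are no multiple edges, and a singleton edge is a loop.
\<close>

type_synonym 'v ugraph = "'v set \<times> 'v set set"

definition is_graph :: "'v ugraph \<Rightarrow> bool" where
  "is_graph G \<longleftrightarrow>
     finite (fst G) \<and> (\<forall>e\<in>snd G. e \<subseteq> fst G \<and> (card e = 1 \<or> card e = 2))"

definition graph_iso :: "'v ugraph \<Rightarrow> 'v ugraph \<Rightarrow> bool" where
  "graph_iso G H \<longleftrightarrow>
     (\<exists>f. bij_betw f (fst G) (fst H) \<and> snd H = (\<lambda>e. f ` e) ` snd G)"

definition graph_property :: "'v ugraph set \<Rightarrow> bool" where
  "graph_property D \<longleftrightarrow>
     (\<forall>G\<in>D. is_graph G) \<and>
     (\<forall>G H. G \<in> D \<longrightarrow> is_graph H \<longrightarrow> graph_iso G H \<longrightarrow> H \<in> D)"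

definition closed_adding_isolated :: "'v ugraph set \<Rightarrow> bool" where
  "closed_adding_isolated D \<longleftrightarrow>
     (\<forall>V E W. (V, E) \<in> D \<longrightarrow> finite W \<longrightarrow> W \<inter> V = {} \<longrightarrow> (V \<union> W, E) \<in> D)"

definition P_span :: "'v ugraph set \<Rightarrow> 'v ugraph \<Rightarrow> int poly" where
  "P_span D G = (\<Sum>B | B \<subseteq> snd G \<and> (fst G, B) \<in> D. monom 1 (card B))"

definition dp_equivalent :: "('v ugraph \<Rightarrow> int poly) \<Rightarrow> ('v ugraph \<Rightarrow> int poly) \<Rightarrow> bool" where
  "dp_equivalent P Q \<longleftrightarrow>
     (\<forall>G H. is_graph G \<longrightarrow> is_graph H \<longrightarrow> (P G = P H \<longleftrightarrow> Q G = Q H))"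

end

theory Submission
  imports Defs
begin

text \<open>
  For the property of having exactly \<open>n\<close> edges the polynomial of \<open>G\<close> is
  \<open>(|E(G)| choose n) X^n\<close>. If \<open>1 \<le> m < n\<close>, a graph with \<open>m - 1\<close> edges and one with \<open>m\<close> edges
  are told apart by the polynomial for \<open>m\<close>, while the polynomial for \<open>n\<close> vanishes on both.
\<close>

definition edge_count_property :: "nat \<Rightarrow> 'v ugraph set" where
  "edge_count_property n = {G. is_graph G \<and> card (snd G) = n}"

lemma finite_edges: "is_graph G \<Longrightarrow> finite (snd G)"
  unfolding is_graph_def by (rule finite_subset[of _ "Pow (fst G)"]) auto

text \<open>A bijection on the vertices is injective on sets of vertices, so it maps distinct edges
  to distinct edges. This gives closure of the edge-count property under isomorphism.\<close>

lemma graph_iso_card_edges: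
  assumes "is_graph G" "graph_iso G H"
  shows "card (snd H) = card (snd G)"
proof -
  obtain f where f: "bij_betw f (fst G) (fst H)" "snd H = (\<lambda>e. f ` e) ` snd G"
    using assms(2) unfolding graph_iso_def by blast
  have "inj_on (image f) (Pow (fst G))"
    using f(1) by (simp add: bij_betw_def inj_on_image_Pow)
  moreover have "snd G \<subseteq> Pow (fst G)"
    using assms(1) unfolding is_graph_def by blast
  ultimately have "inj_on (image f) (snd G)"
    by (rule inj_on_subset)
  then show ?thesis
    using f(2) by (simp add: card_image)
qed

lemma graph_property_edge_count: "graph_property (edge_count_property n)"
  unfolding graph_property_def edge_count_property_def
  by (auto dest: graph_iso_card_edges)

lemma closed_adding_isolated_edge_count: "closed_adding_isolated (edge_count_property n)"
  unfolding closed_adding_isolated_def edge_count_property_def is_graph_def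
  by auto

text \<open>Deleting edges from a graph leaves a graph, so membership reduces to the condition on
  cardinality, and each \<open>n\<close>-subset of the edges contributes the same monomial.\<close>

lemma P_span_edge_count:
  assumes "is_graph G"
  shows "P_span (edge_count_property n) G = monom (int (card (snd G) choose n)) n"
proof -
  have "{B. B \<subseteq> snd G \<and> (fst G, B) \<in> edge_count_property n} = {B. B \<subseteq> snd G \<and> card B = n}"
    using assms unfolding edge_count_property_def is_graph_def by auto
  then have "P_span (edge_count_property n) G = (\<Sum>B | B \<subseteq> snd G \<and> card B = n. monom 1 n)"
    unfolding P_span_def by simp
  also have "\<dots> = of_nat (card (snd G) choose n) * monom 1 n"
    using n_subsets[OF finite_edges[OF assms]] by simp
  also have "\<dots> = monom (int (card (snd G) choose n)) n"
    by (simp add: of_nat_poly smult_monom)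
  finally show ?thesis .
qed

text \<open>The polynomials in question depend only on the number of edges; stars serve as witnesses
  for every such number.\<close>

definition star :: "nat \<Rightarrow> nat ugraph" where
  "star k = ({..k}, (\<lambda>i. {0, Suc i}) ` {..<k})"

lemma is_graph_star: "is_graph (star k)"
  unfolding is_graph_def star_def by auto

lemma card_edges_star: "card (snd (star k)) = k"
  unfolding star_def by (simp add: card_image inj_on_def doubleton_eq_iff)

text \<open>Indices are shifted by one so that the smaller edge count is positive and a star with
  one edge fewer exists.\<close>

lemma not_dp_equivalent_edge_count_less:
  assumes "m < n"
  shows "\<not> dp_equivalent (P_span (edge_count_property (Suc m)) :: nat ugraph \<Rightarrow> _)
           (P_span (edge_count_property (Suc n)))"
proof -
  let ?P = "\<lambda>n. P_span (edge_count_property (Suc n)) :: nat ugraph \<Rightarrow> int poly"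
  \<comment> \<open>The coefficients of \<open>X^(m+1)\<close> are 0 and 1.\<close>
  have "?P m (star m) \<noteq> ?P m (star (Suc m))"
    by (simp add: P_span_edge_count is_graph_star card_edges_star binomial_eq_0)
  \<comment> \<open>Both stars have fewer than \<open>Suc n\<close> edges, so both binomials are
    0.\<close>
  moreover have "?P n (star m) = ?P n (star (Suc m))"
    using assms by (simp add: P_span_edge_count is_graph_star card_edges_star binomial_eq_0)
  ultimately show ?thesis
    unfolding dp_equivalent_def using is_graph_star by blast
qed

lemma dp_equivalent_sym: "dp_equivalent P Q \<longleftrightarrow> dp_equivalent Q P"
  unfolding dp_equivalent_def by metis

lemma not_dp_equivalent_edge_count:
  assumes "m \<noteq> n"
  shows "\<not> dp_equivalent (P_span (edge_count_property (Suc m)) :: nat ugraph \<Rightarrow> _)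
           (P_span (edge_count_property (Suc n)))"
proof (cases "m < n")
  case True
  then show ?thesis
    by (rule not_dp_equivalent_edge_count_less)
next
  case False
  with assms have "n < m"
    by simp
  from not_dp_equivalent_edge_count_less[OF this] show ?thesis
    by (subst dp_equivalent_sym)
qed

theorem theorem13:
  "\<exists>S :: (nat ugraph \<Rightarrow> int poly) set.
     infinite S \<and>
     (\<forall>P\<in>S. \<exists>D. graph_property D \<and> closed_adding_isolated D \<and> P = P_span D) \<and>
     pairwise (\<lambda>P Q. \<not> dp_equivalent P Q) S"
proof -
  let ?P = "\<lambda>n. P_span (edge_count_property (Suc n)) :: nat ugraph \<Rightarrow> int poly"
  \<comment> \<open>Reflexivity turns inequivalence for distinct indices into injectivity of the
    family, hence an infinite range.\<close>
  have "dp_equivalent Q Q" for Q :: "nat ugraph \<Rightarrow> int poly"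
    by (simp add: dp_equivalent_def)
  then have "inj ?P"
    using not_dp_equivalent_edge_count by (intro injI) metis
  then have "infinite (range ?P)"
    by (rule range_inj_infinite)
  moreover have "pairwise (\<lambda>P Q. \<not> dp_equivalent P Q) (range ?P)"
    by (auto simp: pairwise_def intro!: not_dp_equivalent_edge_count)
  moreover have "\<forall>P\<in>range ?P. \<exists>D. graph_property D \<and> closed_adding_isolated D \<and> P = P_span D"
    using graph_property_edge_count closed_adding_isolated_edge_count by fast
  ultimately show ?thesis
    by blast
qed

end
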